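(* Suppose that the topological Markov shift $\left(\mathcal{A}_{\mathcal{G}^{Z_\infty}}^{\mathbb{N}},\sigma_{\mathcal{G}^{Z_\infty}}\right)$ is topologically transitive with finite Gurevich entropy. Then the set $\mathcal{R}$ of recurrent points satisfies $$\dim_H(\mathcal{R})\le\frac{h_G\left(\mathcal{A}_{\mathcal{G}^{Z_\infty}}^{\mathbb{N}},\sigma_{\mathcal{G}^{Z_\infty}}\right)}{\log 2}.$$
   Context: $Z_\infty$ is the planar piecewise smooth vector field equal to $(1,2\pi\sin(2\pi x))$ for $y\ge0$ and $(-1,2\pi\sin(2\pi x))$ for $y\le0$. With $P_\infty(x)=1-\cos(2\pi x)$, its trajectory arcs are $I_{2j}=\{(x,P_\infty(x)):j<x<j+1\}$ and $I_{2j+1}=\{(x,-P_\infty(x)):j<x<j+1\}$, $j\in\mathbb{Z}$. $\mathcal{G}^{Z_\infty}$ is the directed graph with vertices the arcs $I_n$, $n\in\mathbb{Z}$ (identified with their labels $n$), and edges the possible transitions of trajectories from one arc to the next: $2l\to2l+1$, $2l\to2l+2$, $2l+1\to2l$, $2l+1\to2l-1$. For a directed graph $\mathcal{G}$ with vertex set $V$, $\mathcal{A}_{\mathcal{G}}^{\mathbb{N}}=\{(a_i)_{i\in\mathbb{N}}\in V^{\mathbb{N}}:a_i\to a_{i+1}\ \forall i\}$ ($\mathbb{N}\ni0$), with left shift $\sigma_{\mathcal{G}}$ and metric $d(a,b)=\sum_{i\in\mathbb{N}}|a_i-b_i|/2^i$. It is topologically transitive if for all $a,b\in V$ there is a path from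 $a$ to $b$. The Gurevich entropy is $h_G(\mathcal{A}_{\mathcal{G}}^{\mathbb{N}},\sigma_{\mathcal{G}})=\sup\{h_{top}(\mathcal{A}_{\mathcal{H}}^{\mathbb{N}},\sigma_{\mathcal{H}}):\mathcal{H}\subset\mathcal{G}\text{ finite}\}$. A point $\gamma$ is recurrent if there is an increasing sequence $(n_k)_{k\in\mathbb{N}}$ of integers with $\lim_{k\to\infty}\sigma^{n_k}(\gamma)=\gamma$; $\mathcal{R}$ is the set of recurrent points. $\dim_H$ is the Hausdorff dimension with respect to the metric $d$. *)

theory Defs
  imports "HOL-Analysis.Analysis" "Graph_Theory.Pair_Digraph" "Graph_Theory.Digraph_Component"
begin

section \<open>The piecewise smooth vector field and its transition graph\<close>

text \<open>On the switching line \<open>y = 0\<close> both formulas apply, so the field is set-valued.\<close>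

definition Z_inf :: "real \<times> real \<Rightarrow> (real \<times> real) set" where
  "Z_inf p =
     {v. snd p \<ge> 0 \<and> v = (1, 2 * pi * sin (2 * pi * fst p))} \<union>
     {v. snd p \<le> 0 \<and> v = (-1, 2 * pi * sin (2 * pi * fst p))}"

definition P_inf :: "real \<Rightarrow> real" where
  "P_inf x = 1 - cos (2 * pi * x)"

text \<open>\<open>div\<close> on \<^typ>\<open>int\<close> rounds down, so \<open>n div 2\<close> is the \<open>j\<close> with \<open>n = 2j\<close> or \<open>n = 2j + 1\<close>.\<close>

definition arc_inf :: "int \<Rightarrow> (real \<times> real) set" where
  "arc_inf n = (let j = real_of_int (n div 2) in
     if even n then {(x, P_inf x) | x. j < x \<and> x < j + 1}
     else {(x, - P_inf x) | x. j < x \<and> x < j + 1})"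

text \<open>
  A trajectory passes from arc \<open>m\<close> to arc \<open>n\<close> if it is continuous, follows \<open>m\<close> up to time \<open>0\<close>,
  is on the switching line at time \<open>0\<close>, and follows \<open>n\<close> from then on.
\<close>

definition transition_inf :: "int \<Rightarrow> int \<Rightarrow> bool" where
  "transition_inf m n \<longleftrightarrow> (\<exists>\<gamma> :: real \<Rightarrow> real \<times> real. \<exists>a b. a < 0 \<and> 0 < b \<and>
     continuous_on {a<..<b} \<gamma> \<and>
     (\<forall>t\<in>{a<..<b} - {0}. \<exists>v\<in>Z_inf (\<gamma> t). (\<gamma> has_vector_derivative v) (at t)) \<and>
     (\<forall>t\<in>{a<..<0}. \<gamma> t \<in> arc_inf m) \<and>
     snd (\<gamma> 0) = 0 \<and>
     (\<forall>t\<in>{0<..<b}. \<gamma> t \<in> arc_inf n))"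

definition G_inf :: "int pair_pre_digraph" where
  "G_inf = \<lparr> pverts = UNIV, parcs = {(m, n). transition_inf m n} \<rparr>"

subsection \<open>The transitions, explicitly\<close>

definition dir_inf :: "int \<Rightarrow> real" where "dir_inf m = (if even m then 1 else -1)"

definition start_inf :: "int \<Rightarrow> int" where
  "start_inf m = (if even m then m div 2 else m div 2 + 1)"

definition end_inf :: "int \<Rightarrow> int" where
  "end_inf m = (if even m then m div 2 + 1 else m div 2)"

lemma dir_inf_cases: "dir_inf m = 1 \<or> dir_inf m = -1"
  by (simp add: dir_inf_def)

lemma arc_inf_iff:
  "p \<in> arc_inf m \<longleftrightarrow> real_of_int (m div 2) < fst p \<and> fst p < real_of_int (m div 2) + 1 \<and>
     snd p = dir_inf m * P_inf (fst p)"
  by (cases p) (auto simp: arc_inf_def dir_inf_def Let_def)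

lemma P_inf_int: "P_inf (real_of_int c) = 0"
proof -
  have "cos (2 * pi * real_of_int c) = 1"
    unfolding cos_one_2pi_int by (rule exI[of _ c]) simp
  thus ?thesis by (simp add: P_inf_def)
qed

lemma P_inf_pos:
  assumes "real_of_int j < x" "x < real_of_int j + 1"
  shows "P_inf x > 0"
proof -
  have "cos (2 * pi * x) \<noteq> 1"
  proof
    assume "cos (2 * pi * x) = 1"
    then obtain k :: int where "2 * pi * x = real_of_int k * 2 * pi"
      unfolding cos_one_2pi_int by blast
    hence "x = real_of_int k" by simp
    with assms have "real_of_int j < real_of_int k" "real_of_int k < real_of_int (j + 1)"
      by simp_all
    thus False unfolding of_int_less_iff by linarith
  qed
  with cos_le_one[of "2 * pi * x"] have "cos (2 * pi * x) < 1" by linarith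
  thus ?thesis by (simp add: P_inf_def)
qed

lemma Z_inf_arc:
  assumes "p \<in> arc_inf m"
  shows "Z_inf p = {(dir_inf m, 2 * pi * sin (2 * pi * fst p))}"
  using assms P_inf_pos[of "m div 2" "fst p"]
  by (auto simp: arc_inf_iff Z_inf_def dir_inf_def split: if_splits)

lemma transition_infD:
  assumes "transition_inf m n"
  shows "end_inf m = start_inf n"
proof -
  obtain \<gamma> :: "real \<Rightarrow> real \<times> real" and a b where ab: "a < 0" "0 < b"
    and cont: "continuous_on {a<..<b} \<gamma>"
    and der: "\<forall>t\<in>{a<..<b} - {0}. \<exists>v\<in>Z_inf (\<gamma> t). (\<gamma> has_vector_derivative v) (at t)"
    and m: "\<forall>t\<in>{a<..<0}. \<gamma> t \<in> arc_inf m" and z: "snd (\<gamma> 0) = 0"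
    and n: "\<forall>t\<in>{0<..<b}. \<gamma> t \<in> arc_inf n"
    using assms unfolding transition_inf_def by blast
  define f where "f t = fst (\<gamma> t)" for t
  have contf: "continuous_on {a<..<b} f"
    unfolding f_def by (intro continuous_intros cont)
  have derk: "(f has_real_derivative dir_inf k) (at t)"
    if "t \<in> {a<..<b} - {0}" "\<gamma> t \<in> arc_inf k" for t k
  proof -
    have "(\<gamma> has_vector_derivative (dir_inf k, 2 * pi * sin (2 * pi * fst (\<gamma> t)))) (at t)"
      using bspec[OF der that(1)] unfolding Z_inf_arc[OF that(2)] by simp
    from has_derivative_fst[OF this[unfolded has_vector_derivative_def]]
    show ?thesis unfolding f_def has_field_derivative_def
      by (rule has_derivative_eq_rhs) (simp add: fun_eq_iff)
  qed
  have tends: "(\<gamma> \<longlongrightarrow> \<gamma> 0) (at 0)"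
    using cont ab by (simp add: continuous_on_eq_continuous_at isCont_def)
  have Pz: "P_inf (f 0) = 0 \<and> real_of_int (k div 2) \<le> f 0 \<and> f 0 \<le> real_of_int (k div 2) + 1"
    if F: "F = at_left 0 \<or> F = at_right 0" and ev: "eventually (\<lambda>t. \<gamma> t \<in> arc_inf k) F"
    for F k
  proof -
    have nb: "F \<noteq> bot"
      using F trivial_limit_at_left_real[of "0::real"] trivial_limit_at_right_real[of "0::real"] by metis
    have g: "(\<gamma> \<longlongrightarrow> \<gamma> 0) F" using F tends by (auto intro: tendsto_within_subset)
    have f: "(f \<longlongrightarrow> f 0) F" unfolding f_def by (intro tendsto_intros g)
    have s: "((\<lambda>t. snd (\<gamma> t)) \<longlongrightarrow> snd (\<gamma> 0)) F" by (intro tendsto_intros g)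
    have p: "((\<lambda>t. dir_inf k * P_inf (f t)) \<longlongrightarrow> dir_inf k * P_inf (f 0)) F"
      unfolding P_inf_def by (intro tendsto_intros f)
    have "eventually (\<lambda>t. snd (\<gamma> t) = dir_inf k * P_inf (f t)) F"
      using ev by eventually_elim (simp add: arc_inf_iff f_def)
    hence "((\<lambda>t. dir_inf k * P_inf (f t)) \<longlongrightarrow> snd (\<gamma> 0)) F"
      using s by (simp cong: tendsto_cong)
    with p have "dir_inf k * P_inf (f 0) = snd (\<gamma> 0)" using nb tendsto_unique by blast
    with z have 1: "P_inf (f 0) = 0" using dir_inf_cases[of k] by auto
    have "eventually (\<lambda>t. real_of_int (k div 2) \<le> f t) F"
      using ev by eventually_elim (simp add: arc_inf_iff f_def)
    hence 2: "real_of_int (k div 2) \<le> f 0" by (rule tendsto_lowerbound[OF f _ nb])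
    have "eventually (\<lambda>t. f t \<le> real_of_int (k div 2) + 1) F"
      using ev by eventually_elim (simp add: arc_inf_iff f_def)
    hence 3: "f 0 \<le> real_of_int (k div 2) + 1" by (rule tendsto_upperbound[OF f _ nb])
    show ?thesis using 1 2 3 by blast
  qed
  have ev1: "eventually (\<lambda>t. \<gamma> t \<in> arc_inf m) (at_left 0)"
    using m ab by (auto simp: eventually_at_left_field)
  have ev2: "eventually (\<lambda>t. \<gamma> t \<in> arc_inf n) (at_right 0)"
    using n ab by (auto simp: eventually_at_right_field)
  note b1 = Pz[OF disjI1[OF refl] ev1] and b2 = Pz[OF disjI2[OF refl] ev2]
  have edge: "f 0 = real_of_int (k div 2) \<or> f 0 = real_of_int (k div 2) + 1"
    if "P_inf (f 0) = 0 \<and> real_of_int (k div 2) \<le> f 0 \<and> f 0 \<le> real_of_int (k div 2) + 1" for k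
    using that P_inf_pos[of "k div 2" "f 0"] by linarith
  have mvt: "f t - f s = (t - s) * dir_inf k"
    if st: "s < t" and sub: "{s..t} \<subseteq> {a<..<b}"
      and arc: "\<And>u. s < u \<Longrightarrow> u < t \<Longrightarrow> u \<noteq> 0 \<and> \<gamma> u \<in> arc_inf k" for s t k
  proof -
    have d: "(f has_real_derivative dir_inf k) (at u)" if "s < u" "u < t" for u
    proof (rule derk)
      have "u \<in> {s..t}" using that by simp
      with sub show "u \<in> {a<..<b} - {0}" using arc[OF that] by blast
    qed (use arc[OF that] in blast)
    have "\<exists>l z. s < z \<and> z < t \<and> (f has_real_derivative l) (at z) \<and> f t - f s = (t - s) * l"
      using st continuous_on_subset[OF contf sub]
      by (rule MVT) (use d in \<open>auto simp: real_differentiable_def\<close>)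
    then show ?thesis using d DERIV_unique by blast
  qed
  have "f 0 - f (a / 2) = (0 - a / 2) * dir_inf m"
    using ab m by (intro mvt) auto
  moreover have "real_of_int (m div 2) < f (a / 2)" "f (a / 2) < real_of_int (m div 2) + 1"
    using m ab by (auto simp: arc_inf_iff f_def)
  ultimately have e: "f 0 = real_of_int (end_inf m)"
    using edge[OF b1] ab by (auto simp: dir_inf_def end_inf_def)
  have "f (b / 2) - f 0 = (b / 2 - 0) * dir_inf n"
    using ab n by (intro mvt) auto
  moreover have "real_of_int (n div 2) < f (b / 2)" "f (b / 2) < real_of_int (n div 2) + 1"
    using n ab by (auto simp: arc_inf_iff f_def)
  ultimately have "f 0 = real_of_int (start_inf n)"
    using edge[OF b2] ab by (auto simp: dir_inf_def start_inf_def)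
  with e show ?thesis by simp
qed

lemma transition_infI:
  assumes e: "end_inf m = start_inf n"
  shows "transition_inf m n"
proof -
  define c where "c = real_of_int (end_inf m)"
  define g :: "int \<Rightarrow> real \<Rightarrow> real \<times> real" where
    "g k t = (c + dir_inf k * t, dir_inf k * P_inf (c + dir_inf k * t))" for k t
  define \<gamma> where "\<gamma> t = (if t \<le> 0 then g m t else g n t)" for t
  have Pc: "P_inf c = 0" unfolding c_def by (rule P_inf_int)
  have am: "g m t \<in> arc_inf m" if "-1 < t" "t < 0" for t
    using that by (auto simp: g_def arc_inf_iff c_def end_inf_def dir_inf_def)
  have an: "g n t \<in> arc_inf n" if "0 < t" "t < 1" for t
    using that unfolding c_def e by (auto simp: g_def arc_inf_iff c_def e start_inf_def dir_inf_def)
  have dd: "dir_inf k * (dir_inf k * x) = x" for k x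
    by (simp add: dir_inf_def)
  have dg: "(g k has_vector_derivative (dir_inf k, 2 * pi * sin (2 * pi * fst (g k t)))) (at t)"
    for k t
  proof -
    have "((\<lambda>t. c + dir_inf k * t) has_real_derivative dir_inf k) (at t)"
      by (auto intro!: derivative_eq_intros)
    moreover have "((\<lambda>t. dir_inf k * P_inf (c + dir_inf k * t)) has_real_derivative
        2 * pi * sin (2 * pi * fst (g k t))) (at t)"
      unfolding P_inf_def g_def
      by (auto intro!: derivative_eq_intros simp: dd algebra_simps)
    ultimately show ?thesis
      unfolding g_def[abs_def] has_real_derivative_iff_has_vector_derivative
      by (rule has_vector_derivative_Pair)
  qed
  have cg: "continuous_on A (g k)" for A k
    using dg by (meson continuous_at_imp_continuous_on has_vector_derivative_continuous)
  have cont: "continuous_on {-1<..<1} \<gamma>"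
  proof (rule continuous_on_subset)
    show "continuous_on ({..0} \<union> {0..}) \<gamma>"
      unfolding \<gamma>_def
    proof (rule continuous_on_cases)
      show "\<forall>t. t \<in> {..0} \<and> \<not> t \<le> 0 \<or> t \<in> {0..} \<and> t \<le> 0 \<longrightarrow> g m t = g n t"
        by (auto simp: g_def Pc)
    qed (auto intro: cg)
  qed auto
  have dm: "(\<gamma> has_vector_derivative (dir_inf m, 2 * pi * sin (2 * pi * fst (\<gamma> t)))) (at t)"
    if "t < 0" for t
    using dg[of m t] that
    by (auto simp: \<gamma>_def intro: has_vector_derivative_transform_within_open[of _ _ _ "{..<0}"])
  have dn: "(\<gamma> has_vector_derivative (dir_inf n, 2 * pi * sin (2 * pi * fst (\<gamma> t)))) (at t)"
    if "t > 0" for t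
    using dg[of n t] that
    by (auto simp: \<gamma>_def intro: has_vector_derivative_transform_within_open[of _ _ _ "{0<..}"])
  have a1: "\<gamma> t \<in> arc_inf m" if "-1 < t" "t < 0" for t
    using am that by (simp add: \<gamma>_def)
  have a2: "\<gamma> t \<in> arc_inf n" if "0 < t" "t < 1" for t
    using an that by (simp add: \<gamma>_def)
  have "\<exists>v\<in>Z_inf (\<gamma> t). (\<gamma> has_vector_derivative v) (at t)" if "t \<in> {-1<..<1} - {0}" for t
  proof (cases "t < 0")
    case True
    then show ?thesis using that dm[of t] Z_inf_arc[OF a1[of t]] by auto
  next
    case False
    then show ?thesis using that dn[of t] Z_inf_arc[OF a2[of t]] by auto
  qed
  moreover have "snd (\<gamma> 0) = 0" by (simp add: \<gamma>_def g_def Pc)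
  ultimately show ?thesis
    unfolding transition_inf_def using cont a1 a2
    by (intro exI[of _ \<gamma>] exI[of _ "-1"] exI[of _ 1]) auto
qed

lemma transition_inf_iff:
  "transition_inf m n \<longleftrightarrow>
     (\<exists>l. (m = 2*l \<and> n = 2*l + 1) \<or> (m = 2*l \<and> n = 2*l + 2) \<or>
          (m = 2*l + 1 \<and> n = 2*l) \<or> (m = 2*l + 1 \<and> n = 2*l - 1))"
proof -
  have "transition_inf m n \<longleftrightarrow> end_inf m = start_inf n"
    using transition_infD transition_infI by blast
  also have "\<dots> \<longleftrightarrow> (if even m then n = m + 1 \<or> n = m + 2 else n = m - 1 \<or> n = m - 2)"
    unfolding end_inf_def start_inf_def by (cases "even m"; cases "even n"; simp; presburger)
  also have "\<dots> \<longleftrightarrow> (\<exists>l. (m = 2*l \<and> n = 2*l + 1) \<or> (m = 2*l \<and> n = 2*l + 2) \<or>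
          (m = 2*l + 1 \<and> n = 2*l) \<or> (m = 2*l + 1 \<and> n = 2*l - 1))"
    by presburger
  finally show ?thesis .
qed

section \<open>Topological Markov shifts\<close>

definition markov_shift :: "'v pair_pre_digraph \<Rightarrow> (nat \<Rightarrow> 'v) set" where
  "markov_shift G = {a. (\<forall>i. a i \<in> pverts G) \<and> (\<forall>i. (a i, a (Suc i)) \<in> parcs G)}"

definition left_shift :: "(nat \<Rightarrow> 'v) \<Rightarrow> nat \<Rightarrow> 'v" where
  "left_shift a = (\<lambda>i. a (Suc i))"

text \<open>
  \<^const>\<open>infsum\<close> is \<open>0\<close> on divergent families; on \<open>markov_shift G_inf\<close> the series always converges
  (\<open>summable_seq_dist\<close> below).
\<close>

definition seq_dist :: "(nat \<Rightarrow> int) \<Rightarrow> (nat \<Rightarrow> int) \<Rightarrow> real" where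
  "seq_dist a b = (\<Sum>\<^sub>\<infinity>i. \<bar>real_of_int (a i) - real_of_int (b i)\<bar> / 2 ^ i)"

definition topologically_transitive :: "'v pair_pre_digraph \<Rightarrow> bool" where
  "topologically_transitive G \<longleftrightarrow> (\<forall>a\<in>pverts G. \<forall>b\<in>pverts G. a \<rightarrow>\<^sup>*\<^bsub>with_proj G\<^esub> b)"

section \<open>Entropy\<close>

text \<open>
  Topological entropy in the sense of Bowen and Dinaburg, with natural logarithms:
  \<open>lim\<^bsub>\<epsilon>\<rightarrow>0\<^esub> limsup\<^bsub>n\<rightarrow>\<infinity>\<^esub> (1/n) log s(n,\<epsilon>)\<close>, where \<open>s(n,\<epsilon>)\<close> is the largest
  cardinality of an \<open>(n,\<epsilon>)\<close>-separated set. The expression is monotone in \<open>\<epsilon>\<close>, so the limit is a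
  supremum. The empty system has entropy \<open>-\<infinity>\<close>.
\<close>

definition separated ::
    "'a set \<Rightarrow> ('a \<Rightarrow> 'a \<Rightarrow> real) \<Rightarrow> ('a \<Rightarrow> 'a) \<Rightarrow> nat \<Rightarrow> real \<Rightarrow> 'a set \<Rightarrow> bool" where
  "separated X d T n \<epsilon> F \<longleftrightarrow>
     F \<subseteq> X \<and> (\<forall>x\<in>F. \<forall>y\<in>F. x \<noteq> y \<longrightarrow> (\<exists>i<n. d ((T ^^ i) x) ((T ^^ i) y) > \<epsilon>))"

definition topological_entropy ::
    "'a set \<Rightarrow> ('a \<Rightarrow> 'a \<Rightarrow> real) \<Rightarrow> ('a \<Rightarrow> 'a) \<Rightarrow> ereal" where
  "topological_entropy X d T =
     (SUP \<epsilon>\<in>{0<..}. limsup (\<lambda>n.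
        (SUP F\<in>{F. finite F \<and> F \<noteq> {} \<and> separated X d T n \<epsilon> F}. ereal (ln (real (card F)))) / ereal (real n)))"

definition gurevich_entropy :: "int pair_pre_digraph \<Rightarrow> ereal" where
  "gurevich_entropy G =
     (SUP H\<in>{H. pair_fin_digraph H \<and> subgraph (with_proj H) (with_proj G)}.
        topological_entropy (markov_shift H) seq_dist left_shift)"

section \<open>Recurrent points\<close>

definition recurrent_points ::
    "'a set \<Rightarrow> ('a \<Rightarrow> 'a \<Rightarrow> real) \<Rightarrow> ('a \<Rightarrow> 'a) \<Rightarrow> 'a set" where
  "recurrent_points X d T =
     {x \<in> X. \<exists>n :: nat \<Rightarrow> nat. strict_mono n \<and>
        limitin (Metric_space.mtopology X d) (\<lambda>k. (T ^^ n k) x) x sequentially}"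

section \<open>Hausdorff dimension\<close>

definition ediameter :: "('a \<Rightarrow> 'a \<Rightarrow> real) \<Rightarrow> 'a set \<Rightarrow> ennreal" where
  "ediameter d U = (SUP x\<in>U. SUP y\<in>U. ennreal (d x y))"

text \<open>
  The infimum over no covers is \<open>\<infinity>\<close>. Covering sets have diameter at most \<open>\<delta>\<close>, so
  \<^const>\<open>enn2real\<close> loses nothing.
\<close>

definition hausdorff_premeasure ::
    "'a set \<Rightarrow> ('a \<Rightarrow> 'a \<Rightarrow> real) \<Rightarrow> real \<Rightarrow> real \<Rightarrow> 'a set \<Rightarrow> ennreal" where
  "hausdorff_premeasure X d s \<delta> A =
     (INF U\<in>{U :: nat \<Rightarrow> 'a set. (\<forall>i. U i \<subseteq> X \<and> ediameter d (U i) \<le> ennreal \<delta>) \<and> A \<subseteq> (\<Union>i. U i)}.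
        \<Sum>i. ennreal (enn2real (ediameter d (U i)) powr s))"

definition hausdorff_measure ::
    "'a set \<Rightarrow> ('a \<Rightarrow> 'a \<Rightarrow> real) \<Rightarrow> real \<Rightarrow> 'a set \<Rightarrow> ennreal" where
  "hausdorff_measure X d s A = (SUP \<delta>\<in>{0<..}. hausdorff_premeasure X d s \<delta> A)"

text \<open>
  Restricting to \<open>s > 0\<close> avoids a convention for \<open>0\<^sup>0\<close> (\<open>0 powr 0 = 0\<close> in HOL) and
  does not affect the infimum.
\<close>

definition hausdorff_dim :: "'a set \<Rightarrow> ('a \<Rightarrow> 'a \<Rightarrow> real) \<Rightarrow> 'a set \<Rightarrow> ereal" where
  "hausdorff_dim X d A = (INF s\<in>{s. s > 0 \<and> hausdorff_measure X d s A = 0}. ereal s)"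

section \<open>The shift space of the field is a metric space\<close>

lemma markov_shift_G_inf_growth:
  assumes "a \<in> markov_shift G_inf"
  shows "\<bar>a i - a 0\<bar> \<le> 2 * int i"
proof (induction i)
  case (Suc i)
  have "transition_inf (a i) (a (Suc i))"
    using assms by (auto simp: markov_shift_def G_inf_def)
  hence "\<bar>a (Suc i) - a i\<bar> \<le> 2" by (auto simp: transition_inf_iff)
  with Suc show ?case by simp
qed simp

lemma summable_seq_dist:
  assumes "a \<in> markov_shift G_inf" "b \<in> markov_shift G_inf"
  shows "(\<lambda>i. \<bar>real_of_int (a i) - real_of_int (b i)\<bar> / 2 ^ i) summable_on UNIV"
proof -
  define C where "C = real_of_int \<bar>a 0 - b 0\<bar> + 4"
  have "summable (\<lambda>i. real (Suc i) * (1/2) ^ i)"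
    using geometric_deriv_sums[of "1/2::real"] by (simp add: sums_iff)
  hence "summable (\<lambda>i. C * (real (Suc i) * (1/2) ^ i))" by (rule summable_mult)
  moreover have "norm (\<bar>real_of_int (a i) - real_of_int (b i)\<bar> / 2 ^ i)
      \<le> C * (real (Suc i) * (1/2) ^ i)" for i
  proof -
    have "\<bar>a i - b i\<bar> \<le> \<bar>a 0 - b 0\<bar> + 4 * int i"
      using markov_shift_G_inf_growth[OF assms(1), of i] markov_shift_G_inf_growth[OF assms(2), of i]
      by linarith
    hence "\<bar>real_of_int (a i) - real_of_int (b i)\<bar> \<le> real_of_int (\<bar>a 0 - b 0\<bar> + 4 * int i)"
      by linarith
    also have "\<dots> \<le> C * real (Suc i)"
      unfolding C_def by (simp add: algebra_simps)
    finally show ?thesis by (simp add: power_one_over divide_right_mono)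
  qed
  ultimately have "summable (\<lambda>i. norm (\<bar>real_of_int (a i) - real_of_int (b i)\<bar> / 2 ^ i))"
    by (intro summable_comparison_test[OF _ \<open>summable (\<lambda>i. C * _ i)\<close>]) auto
  thus ?thesis by (rule norm_summable_imp_summable_on)
qed

lemma Metric_space_G_inf: "Metric_space (markov_shift G_inf) seq_dist"
proof
  let ?f = "\<lambda>a b i. \<bar>real_of_int (a i) - real_of_int (b i)\<bar> / 2 ^ i"
  show "0 \<le> seq_dist a b" for a b
    unfolding seq_dist_def by (intro infsum_nonneg) auto
  show "seq_dist a b = seq_dist b a" for a b
    unfolding seq_dist_def by (simp add: abs_minus_commute)
  fix a b assume ab: "a \<in> markov_shift G_inf" "b \<in> markov_shift G_inf"
  show "seq_dist a b = 0 \<longleftrightarrow> a = b"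
  proof
    assume 0: "seq_dist a b = 0"
    have "?f a b i = 0" for i
      by (rule nonneg_infsum_le_0D[OF _ summable_seq_dist[OF ab]]) (use 0 in \<open>auto simp: seq_dist_def\<close>)
    thus "a = b" by (intro ext) simp
  qed (simp add: seq_dist_def)
  fix c assume c: "c \<in> markov_shift G_inf"
  have "seq_dist a c \<le> (\<Sum>\<^sub>\<infinity>i. ?f a b i + ?f b c i)"
    unfolding seq_dist_def
  proof (rule infsum_mono)
    show "?f a c summable_on UNIV" by (rule summable_seq_dist[OF ab(1) c])
    show "(\<lambda>i. ?f a b i + ?f b c i) summable_on UNIV"
      by (intro summable_on_add summable_seq_dist ab c)
    show "?f a c i \<le> ?f a b i + ?f b c i" for i
      unfolding add_divide_distrib[symmetric] by (intro divide_right_mono) auto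
  qed
  also have "\<dots> = seq_dist a b + seq_dist b c"
    unfolding seq_dist_def by (intro infsum_add summable_seq_dist ab c)
  finally show "seq_dist a c \<le> seq_dist a b + seq_dist b c" .
qed

end

theory Submission
  imports Defs
begin

text \<open>
  A point of the shift is the same thing as a nearest-neighbour walk on the integers: arc \<open>m\<close> is the
  step from \<open>start_inf m\<close> to \<open>end_inf m\<close>. There are \<open>2 ^ n\<close> walks of length \<open>n\<close> from a given site, and
  the corresponding cylinders have diameter \<open>O(2\<^sup>-\<^sup>n)\<close>, so already the whole space has dimension at
  most \<open>1\<close>. Conversely, the walks of length \<open>n\<close> from \<open>p\<close> confined to the strip \<open>0 < p < M\<close> number at
  least \<open>\<mu> ^ n * sin (pi * p / M)\<close> with \<open>\<mu> = 2 * cos (pi / M)\<close>, because \<open>sin (pi * p / M)\<close> is a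
  Dirichlet eigenfunction of the adjacency operator on the strip. Hence the Gurevich entropy is at
  least \<open>ln \<mu>\<close>, which tends to \<open>ln 2\<close> as \<open>M\<close> grows.
\<close>

section \<open>The shift as a space of walks\<close>

lemma transition_inf_eq: "transition_inf m n \<longleftrightarrow> end_inf m = start_inf n"
  using transition_infD transition_infI by blast

lemma markov_shift_G_inf_iff:
  "a \<in> markov_shift G_inf \<longleftrightarrow> (\<forall>i. end_inf (a i) = start_inf (a (Suc i)))"
  by (simp add: markov_shift_def G_inf_def transition_inf_eq)

lemma left_shift_in_markov_shift: "a \<in> markov_shift G \<Longrightarrow> left_shift a \<in> markov_shift G"
  by (simp add: markov_shift_def left_shift_def)

lemma left_shift_funpow: "(left_shift ^^ k) a = (\<lambda>i. a (k + i))"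
  by (induction k) (simp_all add: left_shift_def)

text \<open>Exactly two arcs leave a site \<open>p\<close>: the rightward arc \<open>2 * p\<close>
  and the leftward arc \<open>2 * p - 1\<close>. Hence a walk is coded by its starting site and its
  sequence of parities.\<close>

lemma arc_eqI: "start_inf m = start_inf n \<Longrightarrow> even m = even n \<Longrightarrow> m = n"
  unfolding start_inf_def by (auto split: if_splits; presburger)

section \<open>Small cylinders and the upper bound on the dimension\<close>

text \<open>Two arcs leaving the same site have labels at most 1 apart, and each label moves by at
  most 2 per step. So the i-th labels differ by at most \<open>4 * (i + 1)\<close>, and these
  bounds, weighted by \<open>1 / 2 ^ i\<close>, sum to 16.\<close>

lemma seq_dist_le_16:
  assumes a: "a \<in> markov_shift G_inf" and b: "b \<in> markov_shift G_inf"
    and s: "start_inf (a 0) = start_inf (b 0)"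
  shows "seq_dist a b \<le> 16"
proof -
  have sums: "(\<lambda>i. 4 * (real (Suc i) * (1/2) ^ i)) sums 16"
    using sums_mult[OF geometric_deriv_sums[of "1/2::real"], of 4] by (simp add: power2_eq_square)
  have "\<bar>a 0 - b 0\<bar> \<le> 1"
    using s unfolding start_inf_def by (auto split: if_splits; presburger)
  hence "\<bar>a i - b i\<bar> \<le> 4 * (int i + 1)" for i
    using markov_shift_G_inf_growth[OF a, of i] markov_shift_G_inf_growth[OF b, of i] by simp
  hence "real_of_int \<bar>a i - b i\<bar> \<le> real_of_int (4 * (int i + 1))" for i
    unfolding of_int_le_iff by blast
  hence "\<bar>real_of_int (a i) - real_of_int (b i)\<bar> \<le> 4 * real (Suc i)" for i
    by (simp add: add.commute)
  hence le: "\<bar>real_of_int (a i) - real_of_int (b i)\<bar> / 2 ^ i \<le> 4 * (real (Suc i) * (1/2) ^ i)" for i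
    by (simp add: power_one_over divide_right_mono)
  have "((\<lambda>i. \<bar>real_of_int (a i) - real_of_int (b i)\<bar> / 2 ^ i) has_sum seq_dist a b) UNIV"
    using summable_seq_dist[OF a b] by (simp add: seq_dist_def)
  from sums_le[OF le has_sum_imp_sums[OF this] sums] show ?thesis .
qed

lemma seq_dist_left_shift:
  assumes a: "a \<in> markov_shift G_inf" and b: "b \<in> markov_shift G_inf" and "a 0 = b 0"
  shows "seq_dist a b = seq_dist (left_shift a) (left_shift b) / 2"
proof -
  let ?f = "\<lambda>a b i. \<bar>real_of_int (a i) - real_of_int (b i)\<bar> / 2 ^ i"
  have sums: "?f a b sums seq_dist a b"
    if "a \<in> markov_shift G_inf" "b \<in> markov_shift G_inf" for a b
    by (rule has_sum_imp_sums) (use summable_seq_dist[OF that] in \<open>simp add: seq_dist_def\<close>)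
  have "(\<lambda>i. ?f a b (Suc i)) = (\<lambda>i. ?f (left_shift a) (left_shift b) i / 2)"
    by (simp add: left_shift_def fun_eq_iff)
  hence "(\<lambda>i. ?f a b (Suc i)) sums (seq_dist (left_shift a) (left_shift b) / 2)"
    using sums_divide[OF sums[OF left_shift_in_markov_shift[OF a] left_shift_in_markov_shift[OF b]]]
    by simp
  hence "?f a b sums (seq_dist (left_shift a) (left_shift b) / 2)"
    using \<open>a 0 = b 0\<close> by (subst (asm) sums_Suc_iff) simp
  with sums[OF a b] show ?thesis by (rule sums_unique2)
qed

text \<open>Equal start and equal parity force equal first arcs, so the shifted walks again start at
  a common site. Each of the \<open>n\<close> shifts halves the distance, and the remaining tails
  are at most 16 apart.\<close>

lemma seq_dist_le_cylinder:
  assumes "a \<in> markov_shift G_inf" "b \<in> markov_shift G_inf"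
    and "start_inf (a 0) = start_inf (b 0)" "\<And>i. i < n \<Longrightarrow> even (a i) = even (b i)"
  shows "seq_dist a b \<le> 16 / 2 ^ n"
  using assms
proof (induction n arbitrary: a b)
  case 0
  then show ?case using seq_dist_le_16 by simp
next
  case (Suc n)
  have eq: "a 0 = b 0" by (rule arc_eqI[OF Suc.prems(3) Suc.prems(4)]) simp
  have "seq_dist (left_shift a) (left_shift b) \<le> 16 / 2 ^ n"
  proof (rule Suc.IH)
    show "start_inf (left_shift a 0) = start_inf (left_shift b 0)"
      using Suc.prems(1,2) eq by (simp add: markov_shift_G_inf_iff left_shift_def) metis
    show "even (left_shift a i) = even (left_shift b i)" if "i < n" for i
      using Suc.prems(4)[of "Suc i"] that by (simp add: left_shift_def)
  qed (use Suc.prems(1,2) left_shift_in_markov_shift in auto)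
  then show ?case using seq_dist_left_shift[OF Suc.prems(1,2) eq] by simp
qed

text \<open>Binary digit \<open>i\<close> of \<open>j\<close> says whether step \<open>i\<close>
  goes right. Numbering the parity words this way indexes the cylinders of length \<open>n\<close>
  at a site by \<open>j < 2 ^ n\<close>.\<close>

definition cylinder :: "int \<Rightarrow> nat \<Rightarrow> nat \<Rightarrow> (nat \<Rightarrow> int) set" where
  "cylinder p n j = {a \<in> markov_shift G_inf. start_inf (a 0) = p \<and> (\<forall>i<n. even (a i) = bit j i)}"

lemma ediameter_cylinder: "ediameter seq_dist (cylinder p n j) \<le> ennreal (16 / 2 ^ n)"
  unfolding ediameter_def cylinder_def
  by (intro SUP_least ennreal_leI seq_dist_le_cylinder) auto

lemma markov_shift_subset_cylinders:
  assumes "a \<in> markov_shift G_inf"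
  shows "\<exists>j<2 ^ n. a \<in> cylinder (start_inf (a 0)) n j"
proof (intro exI conjI)
  let ?j = "horner_sum of_bool 2 (map (\<lambda>i. even (a i)) [0..<n]) :: nat"
  show "?j < 2 ^ n" using horner_sum_of_bool_2_less[of "map (\<lambda>i. even (a i)) [0..<n]"]
    by simp
  show "a \<in> cylinder (start_inf (a 0)) n ?j"
    using assms by (auto simp: cylinder_def bit_horner_sum_bit_iff)
qed

text \<open>The \<open>2 ^ n\<close> cylinders at one site have total weight at most
  \<open>16 powr s * (2 powr (1 - s)) ^ n\<close>, a geometric sequence of ratio below 1 when
  \<open>s > 1\<close>.\<close>

lemma cylinder_weights_small:
  fixes s \<epsilon> \<delta> :: real
  assumes "s > 1" "\<epsilon> > 0" "\<delta> > 0"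
  shows "\<exists>n. 16 / 2 ^ n \<le> \<delta> \<and> 2 ^ n * (16 / 2 ^ n) powr s \<le> \<epsilon>"
proof -
  have eq: "2 ^ n * (16 / 2 ^ n) powr s = 16 powr s * (2 powr (1 - s)) ^ n" for n :: nat
  proof -
    have "(2::real) ^ n / (2 ^ n) powr s = (2 ^ n) powr (1 - s)"
      by (simp add: powr_diff)
    also have "\<dots> = (2 powr (1 - s)) ^ n"
      by (simp add: powr_power powr_powr powr_realpow[symmetric] mult.commute)
    finally have "16 powr s * ((2::real) ^ n / (2 ^ n) powr s) = 16 powr s * (2 powr (1 - s)) ^ n"
      by simp
    thus ?thesis by (simp add: powr_divide mult.commute)
  qed
  have "2 powr (1 - s) < (1::real)" using assms(1) by (simp add: powr_less_one)
  hence "(\<lambda>n. 16 powr s * (2 powr (1 - s)) ^ n) \<longlonglongrightarrow> 16 powr s * 0"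
    by (intro tendsto_intros LIMSEQ_power_zero) simp
  hence 1: "eventually (\<lambda>n. 16 powr s * (2 powr (1 - s)) ^ n < \<epsilon>) sequentially"
    using assms(2) by (intro order_tendstoD(2)[where y = "16 powr s * 0"]) auto
  have "(\<lambda>n. 16 * (1/2) ^ n) \<longlonglongrightarrow> 16 * (0::real)"
    by (intro tendsto_intros LIMSEQ_power_zero) simp
  hence 2: "eventually (\<lambda>n. 16 * (1/2) ^ n < \<delta>) sequentially"
    using assms(3) by (intro order_tendstoD(2)[where y = "16 * 0"]) auto
  from eventually_happens[OF eventually_conj[OF 1 2]] show ?thesis
    unfolding eq by (auto simp: power_one_over intro: less_imp_le)
qed

text \<open>There are infinitely many starting sites, so the cylinder length depends on the site:
  the site with code \<open>c\<close> gets a length \<open>N c\<close> that keeps its share of the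
  weight below \<open>\<epsilon> / 2 ^ (c + 1)\<close>.\<close>

lemma hausdorff_premeasure_le:
  assumes s: "s > 1" and \<delta>: "\<delta> > 0" and A: "A \<subseteq> markov_shift G_inf" and \<epsilon>: "\<epsilon> > 0"
  shows "hausdorff_premeasure (markov_shift G_inf) seq_dist s \<delta> A \<le> ennreal \<epsilon>"
proof -
  have "\<exists>n. 16 / 2 ^ n \<le> \<delta> \<and> 2 ^ n * (16 / 2 ^ n) powr s \<le> \<epsilon> * (1/2) ^ Suc c" for c :: nat
    by (rule cylinder_weights_small[OF s]) (use \<epsilon> \<delta> in auto)
  then obtain N where N: "\<And>c :: nat. 16 / 2 ^ N c \<le> \<delta>"
      "\<And>c. 2 ^ N c * (16 / 2 ^ N c) powr s \<le> \<epsilon> * (1/2) ^ Suc c"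
    by metis
  \<comment> \<open>Padding with empty sets lets all pairs of naturals serve as indices. The padding
    costs nothing, since \<open>0 powr s = 0\<close>.\<close>
  define V where "V = (\<lambda>(c, j). if j < 2 ^ N c then cylinder (int_decode c) (N c) j else {})"
  define w where "w q = ennreal (enn2real (ediameter seq_dist (V q)) powr s)" for q
  define U where "U k = V (prod_decode k)" for k
  have "U k \<subseteq> markov_shift G_inf" for k
    by (auto simp: U_def V_def cylinder_def split: prod.splits if_splits)
  moreover have "ediameter seq_dist (U k) \<le> ennreal \<delta>" for k
  proof -
    obtain c j where q: "prod_decode k = (c, j)" by fastforce
    have "ediameter seq_dist (cylinder (int_decode c) (N c) j) \<le> ennreal \<delta>"
      using ediameter_cylinder ennreal_leI[OF N(1)[of c]] by (rule order_trans)
    moreover have "ediameter seq_dist {} = 0"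
      by (simp add: ediameter_def bot_ennreal)
    ultimately show ?thesis by (simp add: U_def V_def q)
  qed
  moreover have "A \<subseteq> (\<Union>k. U k)"
  proof
    fix a assume "a \<in> A"
    define c where "c = int_encode (start_inf (a 0))"
    obtain j where "j < 2 ^ N c" "a \<in> cylinder (start_inf (a 0)) (N c) j"
      using markov_shift_subset_cylinders A \<open>a \<in> A\<close> by blast
    hence "a \<in> U (prod_encode (c, j))" by (simp add: U_def V_def c_def)
    thus "a \<in> (\<Union>k. U k)" by blast
  qed
  ultimately have "hausdorff_premeasure (markov_shift G_inf) seq_dist s \<delta> A
      \<le> (\<Sum>k. ennreal (enn2real (ediameter seq_dist (U k)) powr s))"
    unfolding hausdorff_premeasure_def by (intro INF_lower) blast
  also have "\<dots> = (\<Sum>k. w (prod_decode k))"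
    by (simp add: w_def U_def)
  also have "\<dots> = (\<Sum>c. \<Sum>j. w (c, j))"
    by (rule suminf_ennreal_2dimen) simp
  also have "\<dots> \<le> (\<Sum>c. ennreal (\<epsilon> * (1/2) ^ Suc c))"
  proof (intro suminf_le)
    fix c
    have "(\<Sum>j. w (c, j)) = (\<Sum>j<2 ^ N c. w (c, j))"
      using s by (intro suminf_finite) (auto simp: w_def V_def ediameter_def bot_ennreal)
    also have "\<dots> \<le> (\<Sum>j<(2::nat) ^ N c. ennreal ((16 / 2 ^ N c) powr s))"
    proof (intro sum_mono)
      fix j assume "j \<in> {..<(2::nat) ^ N c}"
      hence "ediameter seq_dist (V (c, j)) \<le> ennreal (16 / 2 ^ N c)"
        using ediameter_cylinder by (simp add: V_def)
      hence "enn2real (ediameter seq_dist (V (c, j))) \<le> 16 / 2 ^ N c"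
        by (intro enn2real_leI) auto
      thus "w (c, j) \<le> ennreal ((16 / 2 ^ N c) powr s)"
        unfolding w_def using s by (intro ennreal_leI powr_mono2) auto
    qed
    also have "\<dots> = ennreal (2 ^ N c * (16 / 2 ^ N c) powr s)"
      by (subst sum_ennreal) auto
    also have "\<dots> \<le> ennreal (\<epsilon> * (1/2) ^ Suc c)"
      by (intro ennreal_leI N(2))
    finally show "(\<Sum>j. w (c, j)) \<le> ennreal (\<epsilon> * (1/2) ^ Suc c)" .
  qed auto
  also have "\<dots> = ennreal \<epsilon>"
    using sums_mult[OF power_half_series, of \<epsilon>] \<epsilon>
    by (intro suminf_ennreal_eq) auto
  finally show ?thesis .
qed

lemma hausdorff_dim_le_1:
  assumes "A \<subseteq> markov_shift G_inf"
  shows "hausdorff_dim (markov_shift G_inf) seq_dist A \<le> 1"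
proof (rule ereal_le_epsilon2)
  fix e :: real assume "e > 0"
  have "hausdorff_premeasure (markov_shift G_inf) seq_dist (1 + e) \<delta> A = 0" if "\<delta> > 0" for \<delta>
  proof -
    have le: "hausdorff_premeasure (markov_shift G_inf) seq_dist (1 + e) \<delta> A \<le> 0 + ennreal \<epsilon>"
      if "\<epsilon> > 0" for \<epsilon>
      using hausdorff_premeasure_le[OF _ \<open>\<delta> > 0\<close> assms that] \<open>e > 0\<close> by simp
    have "hausdorff_premeasure (markov_shift G_inf) seq_dist (1 + e) \<delta> A \<le> 0"
      by (rule ennreal_le_epsilon) (rule le)
    thus ?thesis by simp
  qed
  hence "hausdorff_measure (markov_shift G_inf) seq_dist (1 + e) A = 0"
    unfolding hausdorff_measure_def by (simp add: SUP_eq_const)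
  hence "hausdorff_dim (markov_shift G_inf) seq_dist A \<le> ereal (1 + e)"
    unfolding hausdorff_dim_def using \<open>e > 0\<close> by (intro INF_lower) auto
  thus "hausdorff_dim (markov_shift G_inf) seq_dist A \<le> 1 + ereal e"
    by (simp add: add.commute)
qed

section \<open>Walks in a strip and the lower bound on the entropy\<close>

text \<open>The sites \<open>0\<close> and \<open>M\<close> act as an absorbing boundary: arcs
  touching them are dropped, which matches the zeros of \<open>sin (pi * p / M)\<close>.\<close>

definition strip_arcs :: "int \<Rightarrow> int set" where
  "strip_arcs M = {m. start_inf m \<in> {0<..<M} \<and> end_inf m \<in> {0<..<M}}"

definition strip_graph :: "int \<Rightarrow> int pair_pre_digraph" where
  "strip_graph M = \<lparr> pverts = strip_arcs M,
     parcs = {(m, n) \<in> strip_arcs M \<times> strip_arcs M. end_inf m = start_inf n} \<rparr>"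

lemma markov_shift_strip_iff:
  "a \<in> markov_shift (strip_graph M) \<longleftrightarrow> (\<forall>i. a i \<in> strip_arcs M) \<and> a \<in> markov_shift G_inf"
  by (auto simp: markov_shift_def strip_graph_def G_inf_def transition_inf_eq)

lemma finite_strip_arcs: "finite (strip_arcs M)"
proof (rule finite_subset)
  show "strip_arcs M \<subseteq> {0..2 * M}"
    by (auto simp: strip_arcs_def start_inf_def end_inf_def split: if_splits)
qed simp

lemma pair_fin_digraph_strip: "pair_fin_digraph (strip_graph M)"
proof
  show "finite (parcs (strip_graph M))"
    by (rule finite_subset[of _ "strip_arcs M \<times> strip_arcs M"])
      (auto simp: strip_graph_def finite_strip_arcs)
qed (auto simp: strip_graph_def finite_strip_arcs)

lemma subgraph_strip: "subgraph (with_proj (strip_graph M)) (with_proj G_inf)"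
  unfolding subgraph_def
  by (auto simp: strip_graph_def G_inf_def transition_inf_eq compatible_def wf_digraph_def)

section \<open>Counting walks in the strip\<close>

definition cons_seq :: "'v \<Rightarrow> (nat \<Rightarrow> 'v) \<Rightarrow> nat \<Rightarrow> 'v" where
  "cons_seq v a = case_nat v a"

lemma cons_seq_simps [simp]: "cons_seq v a 0 = v" "cons_seq v a (Suc i) = a i"
  by (simp_all add: cons_seq_def)

lemma inj_cons_seq: "inj_on (cons_seq v) A"
  by (rule inj_onI) (metis cons_seq_simps(2) ext)

lemma cons_seq_in_strip:
  assumes "v \<in> strip_arcs M" "a \<in> markov_shift (strip_graph M)" "end_inf v = start_inf (a 0)"
  shows "cons_seq v a \<in> markov_shift (strip_graph M)"
  using assms unfolding markov_shift_strip_iff markov_shift_G_inf_iff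
  by (auto simp: cons_seq_def split: nat.splits)

lemma strip_walk_exists:
  assumes "M \<ge> 3" "0 < p" "p < M"
  shows "\<exists>a \<in> markov_shift (strip_graph M). start_inf (a 0) = p"
proof -
  \<comment> \<open>The walk oscillates along one edge: \<open>u\<close> goes from \<open>p\<close>
    to a neighbour inside the strip and \<open>v\<close> returns. The neighbour is
    \<open>p + 1\<close> unless that is the boundary, and then \<open>p - 1\<close>, which is
    positive because \<open>M \<ge> 3\<close>.\<close>
  define u where "u = (if p + 1 < M then 2 * p else 2 * p - 1)"
  define v where "v = (if p + 1 < M then 2 * p + 1 else 2 * p - 2)"
  have "start_inf u = p" "start_inf v = end_inf u" "end_inf v = p"
    "end_inf u \<in> {0<..<M}" "start_inf u \<in> {0<..<M}"
    using assms by (auto simp: u_def v_def start_inf_def end_inf_def; presburger)+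
  hence "(\<lambda>i. if even i then u else v) \<in> markov_shift (strip_graph M)"
    by (auto simp: markov_shift_strip_iff markov_shift_G_inf_iff strip_arcs_def)
  thus ?thesis by (rule bexI[rotated]) (simp add: \<open>start_inf u = p\<close>)
qed

text \<open>Makes the number of words of length \<open>n\<close> measurable on infinite sequences:
  the members of such a set have pairwise different prefixes of length \<open>n\<close>.\<close>

definition distinguished :: "nat \<Rightarrow> (nat \<Rightarrow> 'v) set \<Rightarrow> bool" where
  "distinguished n F \<longleftrightarrow> (\<forall>a\<in>F. \<forall>b\<in>F. a \<noteq> b \<longrightarrow> (\<exists>i<n. a i \<noteq> b i))"

lemma distinguished_cons_seq:
  assumes "distinguished n F" "distinguished n E" "u \<noteq> v"
  shows "distinguished (Suc n) (cons_seq u ` F \<union> cons_seq v ` E)"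
proof -
  have *: "\<exists>i<Suc n. cons_seq w a i \<noteq> cons_seq w b i"
    if "distinguished n D" "a \<in> D" "b \<in> D" "a \<noteq> b" for a b :: "nat \<Rightarrow> 'a" and D w
  proof -
    from that obtain i where "i < n" "a i \<noteq> b i" unfolding distinguished_def by meson
    thus ?thesis by (intro exI[of _ "Suc i"]) simp
  qed
  have **: "\<exists>i<Suc n. cons_seq u a i \<noteq> cons_seq v b i \<and> cons_seq v b i \<noteq> cons_seq u a i" for a b
    using assms(3) by (intro exI[of _ 0]) simp
  show ?thesis
    unfolding distinguished_def
  proof (intro ballI impI)
    fix a b assume "a \<in> cons_seq u ` F \<union> cons_seq v ` E" "b \<in> cons_seq u ` F \<union> cons_seq v ` E" "a \<noteq> b"
    thus "\<exists>i<Suc n. a i \<noteq> b i"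
      using *[OF assms(1)] *[OF assms(2)] ** by (elim UnE imageE) (simp; metis)+
  qed
qed

text \<open>Induction on \<open>n\<close>, splitting by the first step. Walks from \<open>p\<close>
  arise by prepending an arc to walks from \<open>p + 1\<close> or \<open>p - 1\<close>, and the
  eigenfunction identity adds the two bounds up. Including \<open>p = 0\<close> and
  \<open>p = M\<close> spares a special case for neighbours on the boundary: there the bound is 0
  and the empty set serves.\<close>

lemma strip_walks_many:
  assumes "M \<ge> 3" "0 \<le> p" "p \<le> M"
  shows "\<exists>F. finite F \<and> F \<subseteq> {a \<in> markov_shift (strip_graph M). start_inf (a 0) = p} \<and>
    distinguished n F \<and> (2 * cos (pi / M)) ^ n * sin (pi * p / M) \<le> real (card F)"
  using assms(2,3)
proof (induction n arbitrary: p)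
  case 0
  show ?case
  proof (cases "0 < p \<and> p < M")
    case True
    then obtain a where "a \<in> markov_shift (strip_graph M)" "start_inf (a 0) = p"
      using strip_walk_exists assms(1) by blast
    thus ?thesis by (intro exI[of _ "{a}"]) (auto simp: distinguished_def)
  next
    case False
    hence "p = 0 \<or> p = M" using 0 by linarith
    hence "sin (pi * p / M) = 0" using assms(1) by auto
    thus ?thesis by (intro exI[of _ "{}"]) (auto simp: distinguished_def)
  qed
next
  case (Suc n)
  let ?\<mu> = "2 * cos (pi / M)"
  show ?case
  proof (cases "0 < p \<and> p < M")
    case True
    \<comment> \<open>Recording \<open>F\<close> as an image under \<open>cons_seq v\<close> fixes
      the first arc of all its members. This yields both the disjointness of the two families and
      the distinguishedness of their union.\<close>
    let ?P = "\<lambda>v q F. finite F \<and> F \<subseteq> {a \<in> markov_shift (strip_graph M). start_inf (a 0) = p} \<and>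
      (\<exists>E. F = cons_seq v ` E \<and> distinguished n E) \<and> ?\<mu> ^ n * sin (pi * q / M) \<le> real (card F)"
    have step: "\<exists>F. ?P v q F" if "start_inf v = p" "end_inf v = q" "0 \<le> q" "q \<le> M" for v q
    proof (cases "0 < q \<and> q < M")
      case q: True
      from Suc.IH[OF that(3,4)] obtain E where E: "finite E"
        "E \<subseteq> {a \<in> markov_shift (strip_graph M). start_inf (a 0) = q}" "distinguished n E"
        "?\<mu> ^ n * sin (pi * q / M) \<le> real (card E)" by blast
      have "v \<in> strip_arcs M" using that True q by (simp add: strip_arcs_def)
      hence "cons_seq v ` E \<subseteq> {a \<in> markov_shift (strip_graph M). start_inf (a 0) = p}"
        using E(2) that by (auto intro!: cons_seq_in_strip)
      moreover have "card (cons_seq v ` E) = card E"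
        by (rule card_image[OF inj_cons_seq])
      ultimately show ?thesis using E by (intro exI[of _ "cons_seq v ` E"]) auto
    next
      case False
      hence "q = 0 \<or> q = M" using that by linarith
      hence "sin (pi * q / M) = 0" using assms(1) by auto
      thus ?thesis by (intro exI[of _ "{}"]) (auto simp: distinguished_def)
    qed
    have "\<exists>F. ?P (2 * p) (p + 1) F"
      using True by (intro step) (auto simp: start_inf_def end_inf_def)
    then obtain F where F: "?P (2 * p) (p + 1) F" by blast
    have "\<exists>F. ?P (2 * p - 1) (p - 1) F"
      using True by (intro step) (auto simp: start_inf_def end_inf_def)
    then obtain E where E: "?P (2 * p - 1) (p - 1) E" by blast
    from F E have dist: "distinguished (Suc n) (F \<union> E)"
      using distinguished_cons_seq[of n _ _ "2 * p" "2 * p - 1"] by fastforce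
    have "a 0 = 2 * p" if "a \<in> F" for a using F that by auto
    moreover have "a 0 = 2 * p - 1" if "a \<in> E" for a using E that by auto
    ultimately have disj: "F \<inter> E = {}" by fastforce
    \<comment> \<open>This is \<open>sin (x + h) + sin (x - h) = 2 * cos h * sin x\<close> with
      \<open>h = pi / M\<close> and \<open>x = p * h\<close>.\<close>
    have "sin (pi * (p + 1) / M) + sin (pi * (p - 1) / M) = ?\<mu> * sin (pi * p / M)"
      by (simp add: distrib_left right_diff_distrib add_divide_distrib diff_divide_distrib
          sin_add sin_diff)
    hence "?\<mu> ^ Suc n * sin (pi * p / M) =
        ?\<mu> ^ n * sin (pi * (p + 1) / M) + ?\<mu> ^ n * sin (pi * (p - 1) / M)"
      by (simp add: distrib_left[symmetric] mult_ac)
    also have "\<dots> \<le> real (card F) + real (card E)"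
      using F E by (intro add_mono) auto
    also have "\<dots> = real (card (F \<union> E))"
      using F E disj by (simp add: card_Un_disjoint)
    finally have card: "?\<mu> ^ Suc n * sin (pi * p / M) \<le> real (card (F \<union> E))" .
    have "finite (F \<union> E)" "F \<union> E \<subseteq> {a \<in> markov_shift (strip_graph M). start_inf (a 0) = p}"
      using F E by blast+
    with dist card show ?thesis by blast
  next
    case False
    hence "p = 0 \<or> p = M" using Suc.prems by linarith
    hence "sin (pi * p / M) = 0" using assms(1) by auto
    thus ?thesis by (intro exI[of _ "{}"]) (auto simp: distinguished_def)
  qed
qed

section \<open>From counted walks to entropy\<close>

lemma abs_diff_le_seq_dist:
  assumes "a \<in> markov_shift G_inf" "b \<in> markov_shift G_inf"
  shows "\<bar>real_of_int (a 0) - real_of_int (b 0)\<bar> \<le> seq_dist a b"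
proof -
  have "(\<Sum>i\<in>{0}. \<bar>real_of_int (a i) - real_of_int (b i)\<bar> / 2 ^ i) \<le> seq_dist a b"
    unfolding seq_dist_def
    by (rule finite_sum_le_infsum[OF summable_seq_dist[OF assms]]) auto
  thus ?thesis by simp
qed

text \<open>Shifting by \<open>i\<close> brings the differing labels to position 0, where the weight
  is 1. Distinct integers are at least 1 apart, which exceeds the scale \<open>1/2\<close>.\<close>

lemma separated_if_distinguished:
  assumes "F \<subseteq> markov_shift (strip_graph M)" "distinguished n F"
  shows "separated (markov_shift (strip_graph M)) seq_dist left_shift n (1/2) F"
  unfolding separated_def
proof (intro conjI ballI impI)
  fix a b assume ab: "a \<in> F" "b \<in> F" "a \<noteq> b"
  then obtain i where i: "i < n" "a i \<noteq> b i" using assms(2) unfolding distinguished_def by blast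
  have "(left_shift ^^ i) c \<in> markov_shift G_inf" if "c \<in> F" for c
    using that assms(1) by (induction i) (auto simp: markov_shift_strip_iff left_shift_in_markov_shift)
  from abs_diff_le_seq_dist[OF this[OF ab(1)] this[OF ab(2)]]
  have "\<bar>real_of_int (a i) - real_of_int (b i)\<bar> \<le> seq_dist ((left_shift ^^ i) a) ((left_shift ^^ i) b)"
    by (simp add: left_shift_funpow)
  moreover have "\<bar>real_of_int (a i) - real_of_int (b i)\<bar> \<ge> 1" using i(2) by linarith
  ultimately have "seq_dist ((left_shift ^^ i) a) ((left_shift ^^ i) b) > 1/2" by linarith
  with i(1) show "\<exists>i<n. seq_dist ((left_shift ^^ i) a) ((left_shift ^^ i) b) > 1/2" by blast
qed (use assms in auto)

text \<open>A single scale suffices because the entropy is a supremum over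
  \<open>\<epsilon>\<close>, and the factor \<open>C\<close> only contributes
  \<open>ln C / n\<close>, which vanishes in the limit.\<close>

lemma topological_entropy_ge:
  fixes \<mu> C :: real
  assumes "\<mu> > 0" "C > 0" "\<epsilon> > 0"
    and F: "\<And>n. \<exists>F. finite F \<and> separated X d T n \<epsilon> F \<and> C * \<mu> ^ n \<le> real (card F)"
  shows "ereal (ln \<mu>) \<le> topological_entropy X d T"
proof -
  let ?S = "\<lambda>n. SUP F\<in>{F. finite F \<and> F \<noteq> {} \<and> separated X d T n \<epsilon> F}. ereal (ln (real (card F)))"
  have "(\<lambda>n. ln C / real n + ln \<mu>) \<longlonglongrightarrow> 0 + ln \<mu>"
    by (intro tendsto_intros lim_const_over_n)
  hence "limsup (\<lambda>n. ereal (ln C / real n + ln \<mu>)) = ereal (ln \<mu>)"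
    by (intro lim_imp_Limsup) auto
  moreover have "limsup (\<lambda>n. ereal (ln C / real n + ln \<mu>)) \<le> limsup (\<lambda>n. ?S n / ereal (real n))"
  proof (intro Limsup_mono eventually_mono[OF eventually_gt_at_top[of 0]])
    fix n :: nat assume n: "0 < n"
    obtain F where F: "finite F" "separated X d T n \<epsilon> F" "C * \<mu> ^ n \<le> real (card F)"
      using F by blast
    have pos: "0 < C * \<mu> ^ n" using assms by simp
    hence "F \<noteq> {}" using F(3) by auto
    have "ln C + real n * ln \<mu> = ln (C * \<mu> ^ n)"
      using assms by (simp add: ln_mult ln_realpow)
    also have "\<dots> \<le> ln (real (card F))" using pos F(3) by simp
    finally have "ereal (ln C + real n * ln \<mu>) \<le> ereal (ln (real (card F)))" by simp
    also have "\<dots> \<le> ?S n" using F \<open>F \<noteq> {}\<close> by (intro SUP_upper) auto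
    finally have "ereal (ln C + real n * ln \<mu>) / ereal (real n) \<le> ?S n / ereal (real n)"
      using n by (intro ereal_divide_right_mono) auto
    thus "ereal (ln C / real n + ln \<mu>) \<le> ?S n / ereal (real n)"
      using n by (simp add: add_divide_distrib)
  qed
  ultimately show ?thesis
    unfolding topological_entropy_def using assms(3) by (intro SUP_upper2[of \<epsilon>]) auto
qed

lemma gurevich_entropy_ge_strip:
  assumes "M \<ge> 3"
  shows "ereal (ln (2 * cos (pi / real_of_int M))) \<le> gurevich_entropy G_inf"
proof -
  have M: "real_of_int M \<ge> 3" using assms by simp
  have "pi / real_of_int M < pi / 2" using M by (intro divide_strict_left_mono) auto
  hence cos: "2 * cos (pi / real_of_int M) > 0"
    using M by (intro mult_pos_pos cos_gt_zero) auto
  have "pi / real_of_int M < pi / 1" using M by (intro divide_strict_left_mono) auto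
  hence sin: "sin (pi / real_of_int M) > 0"
    using M by (intro sin_gt_zero) auto
  have "ereal (ln (2 * cos (pi / real_of_int M)))
      \<le> topological_entropy (markov_shift (strip_graph M)) seq_dist left_shift"
  \<comment> \<open>Walks are counted from the site 1, so the constant is the eigenfunction value
    \<open>sin (pi / M)\<close>, positive and independent of \<open>n\<close>.\<close>
  proof (rule topological_entropy_ge[OF cos sin, of "1/2"])
    fix n
    obtain F where F: "finite F" "F \<subseteq> {a \<in> markov_shift (strip_graph M). start_inf (a 0) = 1}"
      "distinguished n F" "(2 * cos (pi / M)) ^ n * sin (pi * real_of_int 1 / M) \<le> real (card F)"
      using strip_walks_many[OF assms, of 1 n] assms by auto
    moreover have "separated (markov_shift (strip_graph M)) seq_dist left_shift n (1/2) F"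
      by (rule separated_if_distinguished) (use F in auto)
    ultimately show "\<exists>F. finite F \<and> separated (markov_shift (strip_graph M)) seq_dist left_shift n (1/2) F \<and>
        sin (pi / M) * (2 * cos (pi / M)) ^ n \<le> real (card F)"
      by (intro exI[of _ F]) (simp add: mult.commute)
  qed simp
  also have "\<dots> \<le> gurevich_entropy G_inf"
    unfolding gurevich_entropy_def
    using pair_fin_digraph_strip subgraph_strip by (intro SUP_upper) blast
  finally show ?thesis .
qed

lemma gurevich_entropy_ge_ln_2: "ereal (ln 2) \<le> gurevich_entropy G_inf"
proof (rule LIMSEQ_le_const2)
  have "(\<lambda>n. pi / real n) \<longlonglongrightarrow> 0" by (rule lim_const_over_n)
  hence "(\<lambda>n. ln (2 * cos (pi / real n))) \<longlonglongrightarrow> ln (2 * cos 0)"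
    by (intro tendsto_intros) auto
  thus "(\<lambda>n. ereal (ln (2 * cos (pi / real n)))) \<longlonglongrightarrow> ereal (ln 2)" by simp
  show "\<exists>N. \<forall>n\<ge>N. ereal (ln (2 * cos (pi / real n))) \<le> gurevich_entropy G_inf"
    using gurevich_entropy_ge_strip[of "int _"] by (intro exI[of _ 3]) auto
qed

theorem theorem7:
  assumes "topologically_transitive G_inf"
    and "\<bar>gurevich_entropy G_inf\<bar> \<noteq> \<infinity>"
  shows "hausdorff_dim (markov_shift G_inf) seq_dist
           (recurrent_points (markov_shift G_inf) seq_dist left_shift)
         \<le> gurevich_entropy G_inf / ereal (ln 2)"
proof -
  have "hausdorff_dim (markov_shift G_inf) seq_dist
      (recurrent_points (markov_shift G_inf) seq_dist left_shift) \<le> 1"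
    by (rule hausdorff_dim_le_1) (auto simp: recurrent_points_def)
  \<comment> \<open>The bounds meet at 1: the dimension is at most 1, and the entropy divided by
    \<open>ln 2\<close> is at least 1.\<close>
  also have "1 = ereal (ln 2) / ereal (ln 2)" by simp
  also have "\<dots> \<le> gurevich_entropy G_inf / ereal (ln 2)"
    by (intro ereal_divide_right_mono gurevich_entropy_ge_ln_2) simp
  finally show ?thesis .
qed

end
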